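(* Let $f\in\mathbb{K}[y_1,\dots,y_k]$ be a monomial of degree $d$ in $k$ variables. For each $n\ge k$, consider the (toric) map $$\phi_n: R_n\to T_n,\qquad x_{(u_1,\dots,u_k)}\mapsto f(t_{u_1},\dots,t_{u_k}).$$ Let $I_n=\ker\phi_n$, and let $I_n^{\pm}$ be the corresponding Laurent ideal. Then $N=2d$ is a stabilization bound for the invariant chain $I_\circ^{\pm}=I_k^{\pm}\subseteq I_{k+1}^{\pm}\subseteq\cdots$ of Laurent ideals.
   Context: $\mathbb{K}$ is a field and $k\ge 1$ is an integer. Let $[n]=\{1,\dots,n\}$ and let $\langle n\rangle^k$ be the set of ordered $k$-tuples $u=(u_1,\dots,u_k)$ of pairwise distinct elements of $[n]$. $R_n=\mathbb{K}[x_u : u\in\langle n\rangle^k]$ and $T_n=\mathbb{K}[t_1,\dots,t_n]$ are polynomial rings, with $R_n\subseteq R_m$ for $n\le m$; $\phi_n$ is a homomorphism of $\mathbb{K}$-algebras. $R_n^{\pm}$ is the localization of $R_n$ at the multiplicative set of all its monomials (the Laurent polynomial ring), and for an ideal $I\subseteq R_n$, the corresponding Laurent ideal is $I^{\pm}=\{gh^{-1}: g\in I,\ h\text{ a monomial of }R_n\}\subseteq R_n^{\pm}$. The symmetric group $\mathfrak{S}_m$ of $[m]$ acts on $\langle m\rangle^k$ by $\sigma(u_1,\dots,u_k)=(\sigma(u_1),\dots,\sigma(u_k))$ and on $R_m$ and $R_m^{\pm}$ by $\mathbb{K}$-algebra automorphisms with $\sigma x_u=x_{\sigma u}$. A chain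 of ideals $J_n\subseteq R_n^{\pm}$ with $J_n\subseteq J_{n+1}$ is invariant if $\mathfrak{S}_mJ_n=\{\sigma g:\sigma\in\mathfrak{S}_m,\ g\in J_n\}\subseteq J_m$ for all $m\ge n$. An integer $N$ is a stabilization bound for an invariant chain if for all $m\ge N$ the ideal of $R_m^{\pm}$ generated by $\mathfrak{S}_mJ_N$ equals $J_m$.
   Formalization: The formal theorem assumes k < 2d, which is automatic if every y_i occurs in f; otherwise, if 2d = k the claim is false (e.g. k = 2, f = y_1: I_2 = 0 but x_(1,2) − x_(1,3) lies in I_3), and if 2d < k the ideal I_{2d} is not in the chain. *)

theory Defs
  imports "HOL-Library.Poly_Mapping" "HOL-Combinatorics.Permutations" "HOL-Algebra.RingHom"
begin

text \<open>
  Exponent vectors are finitely supported functions, and polynomials are finitely supported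
  functions from exponent vectors to coefficients, multiplied by convolution.  Exponents in
  \<^typ>\<open>nat\<close> give polynomials and exponents in \<^typ>\<open>int\<close> give Laurent polynomials, i.e. the
  localization of the polynomial ring at its monomials.
\<close>

type_synonym ('v, 'a) mpoly = "('v \<Rightarrow>\<^sub>0 nat) \<Rightarrow>\<^sub>0 'a"
type_synonym ('v, 'a) laurent = "('v \<Rightarrow>\<^sub>0 int) \<Rightarrow>\<^sub>0 'a"

text \<open>
  The (Laurent) polynomials in the variables \<open>V\<close>, as a subring of the (Laurent) polynomials in
  all variables of type \<^typ>\<open>'v\<close>, so that \<open>V \<subseteq> W\<close> yields an inclusion of rings.
\<close>

definition mpoly_ring :: "'v set \<Rightarrow> (('v \<Rightarrow>\<^sub>0 'e::comm_monoid_add) \<Rightarrow>\<^sub>0 'a::comm_ring_1) ring" where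
  "mpoly_ring V = \<lparr>carrier = {p. \<forall>e \<in> Poly_Mapping.keys p. Poly_Mapping.keys e \<subseteq> V},
                  mult = (*), one = 1, zero = 0, add = (+)\<rparr>"

text \<open>If \<^term>\<open>mpoly_ring V\<close> were not a ring, the generated ideal \<open>Idl\<close> below would be the whole type.\<close>

lemma cring_mpoly_ring:
  "cring (mpoly_ring V :: (('v \<Rightarrow>\<^sub>0 'e::comm_monoid_add) \<Rightarrow>\<^sub>0 'a::comm_ring_1) ring)"
  (is "cring ?R")
proof (rule cringI)
  have add: "Poly_Mapping.keys e \<subseteq> V"
    if "e \<in> Poly_Mapping.keys (p + q)" "\<forall>e \<in> Poly_Mapping.keys p. Poly_Mapping.keys e \<subseteq> V" "\<forall>e \<in> Poly_Mapping.keys q. Poly_Mapping.keys e \<subseteq> V"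
    for e and p q :: "('v \<Rightarrow>\<^sub>0 'e) \<Rightarrow>\<^sub>0 'a"
    using that Poly_Mapping.keys_add[of p q] by blast
  have mult: "Poly_Mapping.keys e \<subseteq> V"
    if e: "e \<in> Poly_Mapping.keys (p * q)" and p: "\<forall>e \<in> Poly_Mapping.keys p. Poly_Mapping.keys e \<subseteq> V" and q: "\<forall>e \<in> Poly_Mapping.keys q. Poly_Mapping.keys e \<subseteq> V"
    for e and p q :: "('v \<Rightarrow>\<^sub>0 'e) \<Rightarrow>\<^sub>0 'a"
  proof -
    obtain a b where "e = a + b" "a \<in> Poly_Mapping.keys p" "b \<in> Poly_Mapping.keys q"
      using keys_mult[of p q] e by blast
    then show ?thesis using Poly_Mapping.keys_add[of a b] p q by blast
  qed
  have neg: "-p \<in> carrier ?R" if "p \<in> carrier ?R" for p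
    using that by (simp add: mpoly_ring_def in_keys_iff)
  show "abelian_group ?R"
  proof (rule abelian_groupI)
    show "\<exists>y\<in>carrier ?R. y \<oplus>\<^bsub>?R\<^esub> x = \<zero>\<^bsub>?R\<^esub>" if "x \<in> carrier ?R" for x
      using neg[OF that] by (intro bexI[of _ "-x"]) (auto simp: mpoly_ring_def)
  qed (use add in \<open>auto simp: mpoly_ring_def ac_simps\<close>)
  show "Group.comm_monoid ?R"
    by (rule comm_monoidI) (use mult in \<open>auto simp: mpoly_ring_def ac_simps\<close>)
qed (simp add: mpoly_ring_def distrib_right)

definition monomials :: "'v set \<Rightarrow> ('v, 'a::zero_neq_one) mpoly set" where
  "monomials V = {Poly_Mapping.single e 1 | e. Poly_Mapping.keys e \<subseteq> V}"

definition var :: "'v \<Rightarrow> ('v, 'a::zero_neq_one) mpoly" where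
  "var v = Poly_Mapping.single (Poly_Mapping.single v 1) 1"

definition total_degree :: "('v, 'a::zero) mpoly \<Rightarrow> nat" where
  "total_degree p =
     Max ((\<lambda>e. \<Sum>v\<in>Poly_Mapping.keys e. Poly_Mapping.lookup e v) ` Poly_Mapping.keys p)"

definition subst ::
    "('v \<Rightarrow> ('w, 'a::comm_ring_1) mpoly) \<Rightarrow> ('v, 'a) mpoly \<Rightarrow> ('w, 'a) mpoly" where
  "subst g p =
     (\<Sum>e\<in>Poly_Mapping.keys p. Poly_Mapping.single 0 (Poly_Mapping.lookup p e) *
        (\<Prod>v\<in>Poly_Mapping.keys e. g v ^ Poly_Mapping.lookup e v))"

text \<open>Push-forward along a map \<open>h\<close> of the index sets: \<open>\<Sum> c\<^sub>x x\<close> is sent to \<open>\<Sum> c\<^sub>x h(x)\<close>.\<close>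

definition push_keys :: "('x \<Rightarrow> 'y) \<Rightarrow> ('x \<Rightarrow>\<^sub>0 'b::comm_monoid_add) \<Rightarrow> ('y \<Rightarrow>\<^sub>0 'b)" where
  "push_keys h p = (\<Sum>x\<in>Poly_Mapping.keys p. Poly_Mapping.single (h x) (Poly_Mapping.lookup p x))"

definition to_laurent :: "('v, 'a::comm_ring_1) mpoly \<Rightarrow> ('v, 'a) laurent" where
  "to_laurent = push_keys (Poly_Mapping.map int)"

definition laurent_ideal :: "'v set \<Rightarrow> ('v, 'a::comm_ring_1) mpoly set \<Rightarrow> ('v, 'a) laurent set" where
  "laurent_ideal V I =
     {to_laurent g \<otimes>\<^bsub>mpoly_ring V\<^esub> inv\<^bsub>mpoly_ring V\<^esub> to_laurent h | g h. g \<in> I \<and> h \<in> monomials V}"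

definition tuples :: "nat \<Rightarrow> nat \<Rightarrow> nat list set" where
  "tuples k n = {u. length u = k \<and> distinct u \<and> set u \<subseteq> {1..n}}"

text \<open>
  The formula for \<open>\<phi>\<^sub>n\<close> does not depend on \<open>n\<close>; only its domain and codomain do.
  Variables \<open>y\<^sub>1, \<dots>, y\<^sub>k\<close> are numbered from 1, list positions from 0.
\<close>

definition toric_map :: "(nat, 'a::comm_ring_1) mpoly \<Rightarrow> (nat list, 'a) mpoly \<Rightarrow> (nat, 'a) mpoly" where
  "toric_map f = subst (\<lambda>u. subst (\<lambda>i. var (u ! (i - 1))) f)"

definition toric_ideal :: "nat \<Rightarrow> (nat, 'a::comm_ring_1) mpoly \<Rightarrow> nat \<Rightarrow> (nat list, 'a) mpoly set" where
  "toric_ideal k f n = a_kernel (mpoly_ring (tuples k n)) (mpoly_ring {1..n}) (toric_map f)"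

definition toric_laurent_ideal ::
    "nat \<Rightarrow> (nat, 'a::comm_ring_1) mpoly \<Rightarrow> nat \<Rightarrow> (nat list, 'a) laurent set" where
  "toric_laurent_ideal k f n = laurent_ideal (tuples k n) (toric_ideal k f n)"

text \<open>The inner push-forward acts on exponent vectors, the outer one on Laurent polynomials.\<close>

definition perm_act :: "(nat \<Rightarrow> nat) \<Rightarrow> (nat list, 'a::comm_ring_1) laurent \<Rightarrow> (nat list, 'a) laurent" where
  "perm_act \<sigma> = push_keys (push_keys (map \<sigma>))"

definition sym_orbit :: "nat \<Rightarrow> (nat list, 'a::comm_ring_1) laurent set \<Rightarrow> (nat list, 'a) laurent set" where
  "sym_orbit m J = {perm_act \<sigma> g | \<sigma> g. \<sigma> permutes {1..m} \<and> g \<in> J}"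

text \<open>Chains are indexed by \<open>n \<ge> k\<close>; the values \<open>J n\<close> for \<open>n < k\<close> are irrelevant.\<close>

definition invariant_chain :: "nat \<Rightarrow> (nat \<Rightarrow> (nat list, 'a::comm_ring_1) laurent set) \<Rightarrow> bool" where
  "invariant_chain k J \<longleftrightarrow>
     (\<forall>n\<ge>k. ideal (J n) (mpoly_ring (tuples k n))) \<and>
     (\<forall>n\<ge>k. J n \<subseteq> J (Suc n)) \<and>
     (\<forall>n m. k \<le> n \<and> n \<le> m \<longrightarrow> sym_orbit m (J n) \<subseteq> J m)"

text \<open>
  A bound \<open>N\<close> has to be an index of the chain, whence \<open>k \<le> N\<close>.  For a monomial \<open>f\<close> of degree \<open>d\<close> in
  which all of \<open>y\<^sub>1, \<dots>, y\<^sub>k\<close> occur, \<open>k \<le> d\<close>, so \<open>k < 2 * d\<close> holds automatically.  If some \<open>y\<^sub>i\<close> does not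
  occur, then \<open>2 * d = k\<close> is possible but is not a stabilization bound: for \<open>k = 4\<close> and \<open>f = y\<^sub>1 y\<^sub>2\<close>
  the binomial \<open>x\<^bsub>(1,2,3,4)\<^esub> - x\<^bsub>(1,2,3,5)\<^esub>\<close> is not in the ideal generated by the orbit of \<open>J 4\<close>.
\<close>

definition stabilization_bound ::
    "nat \<Rightarrow> (nat \<Rightarrow> (nat list, 'a::comm_ring_1) laurent set) \<Rightarrow> nat \<Rightarrow> bool" where
  "stabilization_bound k J N \<longleftrightarrow>
     k \<le> N \<and> (\<forall>m\<ge>N. Idl\<^bsub>mpoly_ring (tuples k m)\<^esub> (sym_orbit m (J N)) = J m)"

end

theory Submission
  imports Defs
begin

text \<open>
  Write \<open>f = \<Prod> y\<^sub>j ^ w\<^sub>j\<close>, so that \<open>d = \<Sum> w\<^sub>j\<close>.  The map \<open>\<phi>\<^sub>n\<close> sends monomials to monomials.  On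
  exponents it is the homomorphism \<open>A\<close> from \<open>\<int>\<^bsup>\<langle>n\<rangle>\<^sup>k\<^esup>\<close> to \<open>\<int>\<^bsup>n\<^esup>\<close> with
  \<open>A e\<^sub>u = \<Sum> w\<^sub>j e\<^bsub>u\<^sub>j\<^esub>\<close>, and a Laurent polynomial lies in the Laurent ideal exactly when
  its push-forward along \<open>A\<close> vanishes (\<open>toric_laurent_ideal_eq\<close>).  Such a kernel is generated by the
  binomials \<open>x\<^sup>c - 1\<close> with \<open>A c = 0\<close> (\<open>push_kernel_subset_ideal\<close>), and the exponents \<open>c\<close> with
  \<open>x\<^sup>c - 1\<close> in a given ideal form a group.  This turns the claim into one about
  lattices: for \<open>m \<ge> 2 d\<close>, a subgroup \<open>H\<close> which contains every \<open>c\<close> with \<open>A c = 0\<close> whose words use at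
  most \<open>2 d\<close> of the \<open>m\<close> letters contains every \<open>c\<close> with \<open>A c = 0\<close> (\<open>kernel_subset\<close>); indeed, a
  permutation carries any \<open>2 d\<close> letters to \<open>1, \<dots>, 2 d\<close>.

  For \<open>m = 2 d\<close> this is trivial.  For \<open>m > 2 d\<close>, compute modulo \<open>H\<close>.  The class of
  \<open>e\<^sub>u - e\<^bsub>u'\<^esub>\<close>, where \<open>u'\<close> arises from \<open>u\<close> by replacing the letter \<open>p\<close> in position \<open>i\<close> by \<open>q\<close>,
  depends on \<open>i\<close>, \<open>p\<close>, \<open>q\<close> only (\<open>move_independent\<close>).  As any two words are connected by single replacements, it suffices to see
  that it does not change when one further position is altered (\<open>square\<close>).  The relation in
  question uses \<open>k + 2\<close> letters, which is fine if \<open>k + 2 \<le> 2 d\<close>.  Otherwise \<open>k \<ge> 2 d - 1\<close>, and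
  unless \<open>k = 1\<close> this exceeds \<open>d\<close>, so that some \<open>w\<^sub>l\<close> is zero; then changing the letter in position
  \<open>l\<close> does not affect the class of a word, and this can be used to save one letter, while
  \<open>k + 1 \<le> 2 d\<close> holds by assumption.

  Hence, if \<open>D\<^sub>i p\<close> is the class of replacing \<open>p\<close> in position \<open>i\<close> by a fixed letter \<open>b\<close>, and \<open>u\<^sub>0\<close> is a
  fixed word, then \<open>e\<^sub>u\<close> is congruent to \<open>e\<^bsub>u\<^sub>0\<^esub> + \<Sum>\<^sub>i (D\<^sub>i (u i) - D\<^sub>i (u\<^sub>0 i))\<close>.
  If \<open>A c = 0\<close>, then \<open>\<Sum> c\<^sub>u = 0\<close> because \<open>d > 0\<close>, so \<open>c\<close> is congruent to the sum over \<open>p\<close> of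
  \<open>\<Sum>\<^sub>i n\<^bsub>i p\<^esub> D\<^sub>i p\<close>, where \<open>n\<^bsub>i p\<^esub>\<close> sums those \<open>c\<^sub>u\<close> for which \<open>u\<close> has the letter \<open>p\<close> in
  position \<open>i\<close>.  The coordinate of \<open>A c\<close> at \<open>p\<close> is \<open>\<Sum>\<^sub>i w\<^sub>i n\<^bsub>i p\<^esub> = 0\<close>, and for a given \<open>p\<close> the
  \<open>D\<^sub>i p\<close> can all be represented with the same \<open>k + 1\<close> letters.  So each of these sums is a relation
  on \<open>k + 1\<close> letters and lies in \<open>H\<close>.
\<close>

section \<open>Additive maps and push-forward\<close>

abbreviation (input) "keys \<equiv> Poly_Mapping.keys"
abbreviation (input) "lookup \<equiv> Poly_Mapping.lookup"
abbreviation (input) "single \<equiv> Poly_Mapping.single"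

definition add_hom :: "('x::comm_monoid_add \<Rightarrow> 'y::comm_monoid_add) \<Rightarrow> bool" where
  "add_hom g \<longleftrightarrow> g 0 = 0 \<and> (\<forall>a b. g (a + b) = g a + g b)"

lemma add_homI: "g 0 = 0 \<Longrightarrow> (\<And>a b. g (a + b) = g a + g b) \<Longrightarrow> add_hom g"
  by (simp add: add_hom_def)

lemma add_hom_0: "add_hom g \<Longrightarrow> g 0 = 0"
  and add_hom_add: "add_hom g \<Longrightarrow> g (a + b) = g a + g b"
  by (simp_all add: add_hom_def)

lemma add_hom_sum:
  assumes "add_hom g"
  shows "g (sum h S) = (\<Sum>x\<in>S. g (h x))"
  using assms
  by (induction S rule: infinite_finite_induct) (simp_all add: add_hom_def)

lemma add_hom_diff:
  fixes g :: "'x::ab_group_add \<Rightarrow> 'y::ab_group_add"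
  shows "add_hom g \<Longrightarrow> g (a - b) = g a - g b"
  using add_hom_add[of g "a - b" b] by (simp add: eq_diff_eq)

lemma add_hom_comp: "add_hom g \<Longrightarrow> add_hom h \<Longrightarrow> add_hom (\<lambda>x. g (h x))"
  by (simp add: add_hom_def)

lemma add_hom_single: "add_hom (single x)"
  by (simp add: add_hom_def single_add)

lemma sum_of_singles: "p = (\<Sum>x\<in>keys p. single x (lookup p x))"
proof (rule poly_mapping_eqI)
  fix y
  have "(\<Sum>x\<in>keys p. lookup p x when x = y) = lookup p y"
    by (simp add: when_def in_keys_iff)
  then show "lookup p y = lookup (\<Sum>x\<in>keys p. single x (lookup p x)) y"
    by (simp add: lookup_sum lookup_single)
qed

text \<open>The singles generate all finitely supported functions as an additive monoid.\<close>

lemma add_hom_eqI: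
  assumes "add_hom g" "add_hom h"
    and "\<And>x. x \<in> keys p \<Longrightarrow>
      g (single x (lookup p x)) = h (single x (lookup p x))"
  shows "g p = h p"
proof -
  have "g (\<Sum>x\<in>keys p. single x (lookup p x)) = h (\<Sum>x\<in>keys p. single x (lookup p x))"
    by (simp add: add_hom_sum assms)
  then show ?thesis by (simp flip: sum_of_singles)
qed

lemma add_hom_keys_sum:
  assumes "\<And>x. add_hom (F x)"
  shows "add_hom (\<lambda>p. \<Sum>x\<in>keys p. F x (lookup p x))"
  using assms by (intro add_homI setsum_keys_plus_distrib) (simp_all add: add_hom_def)

lemma add_hom_push_keys: "add_hom (push_keys h)"
  unfolding push_keys_def[abs_def] by (rule add_hom_keys_sum) (rule add_hom_single)

lemma push_keys_single [simp]:
  "push_keys h (single x c) = single (h x) c"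
  by (simp add: push_keys_def)

lemma push_keys_push_keys: "push_keys g (push_keys h p) = push_keys (\<lambda>x. g (h x)) p"
  by (rule add_hom_eqI[where p = p]) (auto intro: add_hom_comp add_hom_push_keys)

lemma push_keys_cong: "(\<And>x. x \<in> keys p \<Longrightarrow> g x = h x) \<Longrightarrow> push_keys g p = push_keys h p"
  unfolding push_keys_def by (rule sum.cong) auto

lemma push_keys_ident: "(\<And>x. x \<in> keys p \<Longrightarrow> g x = x) \<Longrightarrow> push_keys g p = p"
  unfolding push_keys_def by (subst (2) sum_of_singles, rule sum.cong) auto

lemma keys_push_keys: "keys (push_keys h p) \<subseteq> h ` keys p"
  unfolding push_keys_def using keys_sum[of "\<lambda>x. single (h x) (lookup p x)" "keys p"]
  by (auto split: if_splits)

text \<open>Both sides are biadditive, and on singles the claim is that \<open>h\<close> adds exponents.\<close>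

lemma push_keys_mult:
  fixes p q :: "'x::comm_monoid_add \<Rightarrow>\<^sub>0 'b::comm_semiring_1"
  assumes "add_hom h"
  shows "push_keys h (p * q) = push_keys h p * push_keys h q"
proof (rule add_hom_eqI[where p = p])
  fix x
  show "push_keys h (single x (lookup p x) * q) =
      push_keys h (single x (lookup p x)) * push_keys h q"
    by (rule add_hom_eqI[where p = q])
      (auto simp: mult_single add_hom_add[OF assms] distrib_left add_hom_def
        add_hom_add[OF add_hom_push_keys] add_hom_0[OF add_hom_push_keys])
qed (auto simp: add_hom_def distrib_right add_hom_add[OF add_hom_push_keys] add_hom_0[OF add_hom_push_keys])

lemma push_keys_one: "h 0 = 0 \<Longrightarrow> push_keys h 1 = 1"
  by (metis push_keys_single single_one)

lemma push_keys_inj_eq_0: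
  assumes "inj h" "push_keys h p = 0"
  shows "p = 0"
proof -
  have "p = push_keys (\<lambda>x. inv_into UNIV h (h x)) p" using assms(1) by (simp add: push_keys_ident)
  also have "\<dots> = push_keys (inv_into UNIV h) (push_keys h p)" by (rule push_keys_push_keys[symmetric])
  finally show ?thesis by (simp add: assms(2) add_hom_0[OF add_hom_push_keys])
qed

section \<open>Exponents of words\<close>

text \<open>
  The homomorphism that sends the basis vector of a word \<open>u\<close> to \<open>\<Sum> w\<^sub>j e\<^bsub>u\<^sub>j\<^esub>\<close>.  The ring of
  coefficients is left open, since it is \<^typ>\<open>nat\<close> for exponents of polynomials and \<^typ>\<open>int\<close> for
  exponents of Laurent polynomials.
\<close>

definition word_exponent ::
    "nat \<Rightarrow> (nat \<Rightarrow> nat) \<Rightarrow> ('v list \<Rightarrow>\<^sub>0 'b::comm_semiring_1) \<Rightarrow> ('v \<Rightarrow>\<^sub>0 'b)" where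
  "word_exponent k w c =
     (\<Sum>u\<in>keys c. \<Sum>j<k. single (u ! j) (lookup c u * of_nat (w j)))"

lemma add_hom_word_exponent: "add_hom (word_exponent k w)"
  unfolding word_exponent_def[abs_def]
  by (rule add_hom_keys_sum)
    (simp add: add_hom_def distrib_right single_add sum.distrib)

lemma word_exponent_single:
  "word_exponent k w (single u n) = (\<Sum>j<k. single (u ! j) (n * of_nat (w j)))"
  by (simp add: word_exponent_def)

lemma word_exponent_update_diff:
  fixes n :: int
  assumes "length u = k" "i < k"
  shows "word_exponent k w (single u n - single (u[i := q]) n) =
    single (u ! i) (n * of_nat (w i)) - single q (n * of_nat (w i))"
proof -
  have "(\<Sum>j<k. single (u ! j) (n * of_nat (w j)) - single (u[i := q] ! j) (n * of_nat (w j))) =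
    (\<Sum>j<k. if j = i then single (u ! i) (n * of_nat (w i)) - single q (n * of_nat (w i)) else 0)"
    by (rule sum.cong) (use assms in auto)
  then show ?thesis
    using assms by (simp add: add_hom_diff[OF add_hom_word_exponent] word_exponent_single flip: sum_subtractf)
qed

section \<open>Arrangements and their connectedness\<close>

definition arrangements :: "nat \<Rightarrow> 'v set \<Rightarrow> 'v list set" where
  "arrangements k B = {u. length u = k \<and> distinct u \<and> set u \<subseteq> B}"

lemma arrangements_update:
  "u \<in> arrangements k B \<Longrightarrow> q \<in> C \<Longrightarrow> B \<subseteq> C \<Longrightarrow> q \<notin> set u \<Longrightarrow> u[i := q] \<in> arrangements k C"
  using set_update_subset_insert[of u i q] by (auto simp: arrangements_def distinct_list_update)

lemma arrangements_mono: "B \<subseteq> C \<Longrightarrow> arrangements k B \<subseteq> arrangements k C"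
  by (auto simp: arrangements_def)

lemma card_set_arrangement: "u \<in> arrangements k B \<Longrightarrow> card (set u) = k"
  by (auto simp: arrangements_def distinct_card)

lemma in_set_update_iff:
  "distinct u \<Longrightarrow> i < length u \<Longrightarrow> y \<in> set (u[i := x]) \<longleftrightarrow> y = x \<or> y \<in> set u \<and> y \<noteq> u ! i"
  by (auto simp: set_update_distinct)

text \<open>
  Any word can be turned into \<open>v\<close> by replacing one letter at a time.  A position where the words
  differ receives its final letter \<open>v ! j\<close> directly if that letter is unused; if it is used in a
  position \<open>l\<close>, a spare letter is put there first.  This is why more than \<open>k\<close> letters
  are needed.  Only positions where the words differ are touched, so a common letter of \<open>u\<close> and \<open>v\<close>
  stays in place all along.
\<close>

lemma arrangement_connected:
  assumes "finite X" "k < card X" "v \<in> arrangements k X" "u \<in> arrangements k X"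
    and v: "P v"
    and step: "\<And>u j z. u \<in> arrangements k X \<Longrightarrow> j < k \<Longrightarrow> u ! j \<noteq> v ! j \<Longrightarrow> z \<in> X - set u \<Longrightarrow>
        P (u[j := z]) \<Longrightarrow> P u"
  shows "P u"
  using assms(4)
proof (induction "card {j. j < k \<and> u ! j \<noteq> v ! j}" arbitrary: u rule: less_induct)
  case less
  have len: "length u = k" "distinct u" "length v = k" "distinct v" "set v \<subseteq> X"
    using less.prems assms(3) by (auto simp: arrangements_def)
  show ?case
  proof (cases "u = v")
    case False
    then obtain j where j: "j < k" "u ! j \<noteq> v ! j"
      using len by (metis nth_equalityI)
    have reduce: "P u'" if u': "u' \<in> arrangements k X" "u' ! j \<noteq> v ! j" "v ! j \<notin> set u'"
      and sub: "{i. i < k \<and> u' ! i \<noteq> v ! i} \<subseteq> {i. i < k \<and> u ! i \<noteq> v ! i}" for u'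
    proof (rule step[OF u'(1) j(1) u'(2)])
      show z: "v ! j \<in> X - set u'" using u' j len by auto
      have "{i. i < k \<and> u'[j := v ! j] ! i \<noteq> v ! i} \<subset> {i. i < k \<and> u ! i \<noteq> v ! i}"
        using sub j u' by (auto simp: arrangements_def nth_list_update)
      then show "P (u'[j := v ! j])"
        using u' z by (intro less.hyps psubset_card_mono arrangements_update[OF u'(1)]) auto
    qed
    show ?thesis
    proof (cases "v ! j \<in> set u")
      case False
      then show ?thesis using reduce[of u] j less.prems by auto
    next
      case True
      then obtain l where l: "l < k" "u ! l = v ! j"
        using len by (auto simp: in_set_conv_nth)
      have "l \<noteq> j" using l j by auto
      then have ne: "u ! l \<noteq> v ! l" using l j len by (simp add: nth_eq_iff_index_eq)
      have "card (set u) < card X"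
        using card_set_arrangement[OF less.prems] assms(2) by simp
      then obtain z where z: "z \<in> X - set u"
        using assms(1) by (metis Diff_eq_empty_iff card_mono ex_in_conv linorder_not_le List.finite_set)
      show ?thesis
      proof (rule step[OF less.prems l(1) ne z], rule reduce)
        show "u[l := z] \<in> arrangements k X"
          using z by (intro arrangements_update[OF less.prems]) auto
        show "u[l := z] ! j \<noteq> v ! j" using \<open>l \<noteq> j\<close> j by simp
        have "z \<noteq> v ! j" using True z by auto
        then show "v ! j \<notin> set (u[l := z])"
          using len l by (auto simp: in_set_update_iff)
        show "{i. i < k \<and> u[l := z] ! i \<noteq> v ! i} \<subseteq> {i. i < k \<and> u ! i \<noteq> v ! i}"
          using l ne len by (auto simp: nth_list_update split: if_splits)
      qed
    qed
  qed (simp add: v)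
qed

section \<open>Subgroups that contain the relations on few letters\<close>

text \<open>
  A word is the index of a variable, \<open>H\<close> for a group of exponents, and \<open>small\<close> says that \<open>H\<close> contains
  the relations on at most \<open>N\<close> letters.  The assumption \<open>free_position\<close> is what the square
  relation needs: it involves \<open>k + 2\<close> letters, and if these are too many, then a position of weight
  zero serves to get along with \<open>k + 1\<close>; for \<open>k \<le> 1\<close> there are no squares.
\<close>

locale locally_generated =
  fixes k N :: nat and w :: "nat \<Rightarrow> nat" and X :: "'v set" and H :: "('v list \<Rightarrow>\<^sub>0 int) set"
  assumes zero: "0 \<in> H"
    and diff: "\<And>a b. a \<in> H \<Longrightarrow> b \<in> H \<Longrightarrow> a - b \<in> H"
    and small: "\<And>B c. B \<subseteq> X \<Longrightarrow> card B \<le> N \<Longrightarrow> keys c \<subseteq> arrangements k B \<Longrightarrow>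
        word_exponent k w c = 0 \<Longrightarrow> c \<in> H"
    and finite: "finite X"
    and N: "k < N" "N < card X"
    and free_position: "k + 2 \<le> N \<or> k \<le> 1 \<or> (\<exists>l<k. w l = 0)"
    and degree_pos: "0 < (\<Sum>j<k. w j)"
begin

lemma uminus: "a \<in> H \<Longrightarrow> - a \<in> H"
  using diff[OF zero, of a] by simp

lemma add: "a \<in> H \<Longrightarrow> b \<in> H \<Longrightarrow> a + b \<in> H"
  using diff[OF _ uminus, of a b] by simp

lemma sum: "(\<And>x. x \<in> S \<Longrightarrow> h x \<in> H) \<Longrightarrow> sum h S \<in> H"
  by (induction S rule: infinite_finite_induct) (auto intro: zero add)

lemma congruent_trans: "a - b \<in> H \<Longrightarrow> b - c \<in> H \<Longrightarrow> a - c \<in> H"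
  using add[of "a - b" "b - c"] by simp

lemma free_move:
  assumes u: "u \<in> arrangements k X" and l: "l < k" "w l = 0" and z: "z \<in> X - set u"
  shows "single u n - single (u[l := z]) n \<in> H"
proof (rule small)
  show "insert z (set u) \<subseteq> X" using u z by (auto simp: arrangements_def)
  show "card (insert z (set u)) \<le> N"
    using card_set_arrangement[OF u] N by (simp add: card_insert_if)
  have "u \<in> arrangements k (set u)" using u by (auto simp: arrangements_def)
  then have "{u, u[l := z]} \<subseteq> arrangements k (insert z (set u))"
    using z arrangements_mono[of "set u" "insert z (set u)" k]
      arrangements_update[of u k "set u" z "insert z (set u)" l] by auto
  then show "keys (single u n - single (u[l := z]) n) \<subseteq> arrangements k (insert z (set u))"
    using keys_diff[of "single u n" "single (u[l := z]) n"] by (auto split: if_splits)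
  show "word_exponent k w (single u n - single (u[l := z]) n) = 0"
    using u l by (subst word_exponent_update_diff) (auto simp: arrangements_def)
qed

abbreviation move :: "nat \<Rightarrow> 'v \<Rightarrow> int \<Rightarrow> 'v list \<Rightarrow> 'v list \<Rightarrow>\<^sub>0 int" where
  "move i q n u \<equiv> single u n - single (u[i := q]) n"

text \<open>Both replacements change the exponent by \<open>w\<^sub>i (e\<^sub>p - e\<^sub>q)\<close>, where \<open>p\<close> is the common letter.\<close>

lemma small_square:
  assumes B: "B \<subseteq> X" "card B \<le> N"
    and u: "u \<in> arrangements k B" and ij: "i < k" "u ! i = v ! i"
    and v: "v \<in> arrangements k B" and q: "q \<in> B" "q \<notin> set u" "q \<notin> set v"
  shows "move i q n u - move i q n v \<in> H"
proof (rule small[OF B])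
  have *: "{u, u[i := q], v, v[i := q]} \<subseteq> arrangements k B"
    using u v q by (auto intro: arrangements_update)
  have "keys (move i q n u - move i q n v) \<subseteq> {u, u[i := q], v, v[i := q]}"
    using keys_diff[of "move i q n u" "move i q n v"] keys_diff[of "single u n" "single (u[i:=q]) n"]
      keys_diff[of "single v n" "single (v[i:=q]) n"] by (auto split: if_splits)
  with * show "keys (move i q n u - move i q n v) \<subseteq> arrangements k B" by blast
  have "length u = k" "length v = k" using u v by (auto simp: arrangements_def)
  then show "word_exponent k w (move i q n u - move i q n v) = 0"
    using ij by (simp add: add_hom_diff[OF add_hom_word_exponent, of k w "move i q n u"]
        word_exponent_update_diff)
qed

text \<open>
  The letters involved are those of \<open>u\<close> together with \<open>q\<close> and \<open>z\<close>.  If \<open>N\<close> does not allow so many, let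
  \<open>l\<close> be a position of weight zero.  When \<open>l\<close> is \<open>i\<close> or \<open>j\<close>, the relation splits into two free moves.
  Otherwise free moves put into position \<open>l\<close> the letter that position \<open>j\<close> has in the other word;
  after that both words have the same letters, and the former letter of position \<open>l\<close> is saved.
\<close>

lemma square:
  assumes u: "u \<in> arrangements k X" and ij: "i < k" "j < k" "i \<noteq> j"
    and q: "q \<in> X - set u" and z: "z \<in> X - set u" and qz: "q \<noteq> z"
  shows "move i q n u - move i q n (u[j := z]) \<in> H"
proof -
  have len: "length u = k" "distinct u" and uset: "u \<in> arrangements k (set u)"
    using u by (auto simp: arrangements_def)
  have card_u: "card (set u) = k" using card_set_arrangement[OF u] .
  have comm: "u[j := z, i := q] = u[i := q, j := z]" using ij by (simp add: list_update_swap)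
  have uz: "u[j := z] \<in> arrangements k X" and uq: "u[i := q] \<in> arrangements k X"
    using q z by (auto intro!: arrangements_update[OF u])
  have notin: "q \<notin> set (u[j := z])" "z \<notin> set (u[i := q])"
    using q z qz len ij by (auto simp: in_set_update_iff)
  consider "k + 2 \<le> N" | l where "l < k" "w l = 0"
    using free_position ij by force
  then show ?thesis
  proof cases
    case 1
    let ?B = "insert q (insert z (set u))"
    show ?thesis
    proof (rule small_square[where B = ?B])
      show "?B \<subseteq> X" using u q z by (auto simp: arrangements_def)
      show "card ?B \<le> N" using 1 card_u q z by (simp add: card_insert_if)
      show "u \<in> arrangements k ?B" using uset arrangements_mono[of "set u" ?B k] by auto
      show "u[j := z] \<in> arrangements k ?B" using z by (intro arrangements_update[OF uset]) auto
    qed (use ij q notin in auto)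
  next
    case (2 l)
    consider "l = i" | "l = j" | "l \<noteq> i" "l \<noteq> j" by blast
    then show ?thesis
    proof cases
      case 1
      then show ?thesis using free_move[OF u _ _ q, of i n] free_move[OF uz _ _, of i q n] 2 notin q
        by (auto intro: diff)
    next
      case c: 2
      have "move j z n u - move j z n (u[i := q]) \<in> H"
        using 2 c free_move[OF u _ _ z, of j n] free_move[OF uq, of j z n] notin z by (auto intro: diff)
      then show ?thesis by (simp add: comm algebra_simps)
    next
      case 3
      define r where "r = u ! l"
      let ?v = "u[l := z]" and ?v' = "u[j := z, l := u ! j]"
      let ?B = "insert q (insert z (set u - {r}))"
      have rin: "r \<in> set u" using len 2 by (simp add: r_def)
      have ujX: "u ! j \<in> X" using u ij by (auto simp: arrangements_def)
      have lj: "u ! l \<noteq> u ! j" "u ! i \<noteq> u ! l" using 3 2 ij len by (simp_all add: nth_eq_iff_index_eq)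
      have vset: "set ?v = insert z (set u - {r})"
        using len 2 by (simp add: set_update_distinct r_def)
      have uj: "u ! j \<notin> set (u[j := z])"
        using len ij z by (auto simp: in_set_update_iff)
      have "set ?v' = insert (u ! j) (set (u[j := z]) - {u[j := z] ! l})"
        using uz 2 by (intro set_update_distinct) (auto simp: arrangements_def)
      also have "\<dots> = insert z (set u - {r})"
        using len ij z lj 3 2 rin by (auto simp: set_update_distinct r_def)
      finally have v'set: "set ?v' = insert z (set u - {r})" .
      have v: "?v \<in> arrangements k X" using z by (intro arrangements_update[OF u]) auto
      have v': "?v' \<in> arrangements k X" using uj u ij len
        by (intro arrangements_update[OF uz]) (auto simp: arrangements_def)
      \<comment> \<open>The claim is the square for \<open>?v\<close> and \<open>?v'\<close>, plus the free moves at its four corners.\<close>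
      have m0: "move i q n ?v - move i q n ?v' \<in> H"
      proof (rule small_square[where B = ?B])
        show "?B \<subseteq> X" using u q z by (auto simp: arrangements_def)
        have "card (set u - {r}) = k - 1" using rin card_u by simp
        then have "card ?B = k + 1" using q z qz ij by (simp add: card_insert_if)
        then show "card ?B \<le> N" using N by simp
        show "?v \<in> arrangements k ?B" using v vset by (auto simp: arrangements_def)
        show "?v' \<in> arrangements k ?B" using v' v'set by (auto simp: arrangements_def)
        show "q \<notin> set ?v" "q \<notin> set ?v'" unfolding vset v'set using q qz by auto
      qed (use ij 3 in auto)
      have m1: "move l z n u \<in> H"
        using free_move[OF u 2 z] .
      have m2: "move l z n (u[i := q]) \<in> H"
        using free_move[OF uq 2] z notin by auto
      have m3: "move l (u ! j) n (u[j := z]) \<in> H"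
        using free_move[OF uz 2, of "u ! j" n] uj ujX by auto
      have m4: "move l (u ! j) n (u[j := z, i := q]) \<in> H"
      proof (rule free_move[OF _ 2])
        show "u[j := z, i := q] \<in> arrangements k X"
          using notin q by (intro arrangements_update[OF uz]) auto
        have "u ! j \<noteq> q" using q len ij by auto
        then show "u ! j \<in> X - set (u[j := z, i := q])"
          using uj ujX uz len ij by (auto simp: arrangements_def in_set_update_iff)
      qed
      have "move l z n u - move l z n (u[i := q]) - move l (u ! j) n (u[j := z])
         + move l (u ! j) n (u[j := z, i := q]) + (move i q n ?v - move i q n ?v') \<in> H"
        by (rule add[OF add[OF diff[OF diff[OF m1 m2] m3] m4] m0])
      moreover have "u[i := q, l := z] = ?v[i := q]" "u[j := z, i := q, l := u ! j] = ?v'[i := q]"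
        using 3 by (simp_all add: list_update_swap)
      ultimately show ?thesis by (simp add: algebra_simps)
    qed
  qed
qed

text \<open>
  Connect \<open>u\<close> to \<open>v\<close> by single replacements that keep position \<open>i\<close> and avoid \<open>q\<close>.  Each of them is
  covered by the square relation; avoiding \<open>q\<close> is possible because there are at least \<open>k + 2\<close>
  letters.
\<close>

lemma move_independent:
  assumes u: "u \<in> arrangements k X" and v: "v \<in> arrangements k X" and i: "i < k" "u ! i = v ! i"
    and q: "q \<in> X" "q \<notin> set u" "q \<notin> set v"
  shows "move i q n u - move i q n v \<in> H"
proof -
  let ?X = "X - {q}"
  have "u ! i = v ! i \<longrightarrow> move i q n u - move i q n v \<in> H"
  proof (rule arrangement_connected[of ?X k v u])
    show "finite ?X" using finite by simp
    show "k < card ?X" using finite q N by simp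
    show "v \<in> arrangements k ?X" "u \<in> arrangements k ?X" using u v q by (auto simp: arrangements_def)
    show "v ! i = v ! i \<longrightarrow> move i q n v - move i q n v \<in> H" using zero by simp
  next
    fix u j z
    assume u: "u \<in> arrangements k ?X" and j: "j < k" "u ! j \<noteq> v ! j" and z: "z \<in> ?X - set u"
      and IH: "u[j := z] ! i = v ! i \<longrightarrow> move i q n (u[j := z]) - move i q n v \<in> H"
    show "u ! i = v ! i \<longrightarrow> move i q n u - move i q n v \<in> H"
    proof
      assume ui: "u ! i = v ! i"
      then have "i \<noteq> j" using j by auto
      have "move i q n u - move i q n (u[j := z]) \<in> H"
        using u i j z q \<open>i \<noteq> j\<close> by (intro square) (auto simp: arrangements_def)
      moreover have "move i q n (u[j := z]) - move i q n v \<in> H"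
        using IH ui \<open>i \<noteq> j\<close> by simp
      ultimately show "move i q n u - move i q n v \<in> H"
        by (rule congruent_trans)
    qed
  qed
  then show ?thesis using i by simp
qed

lemma arrangement_with_entry:
  assumes "p \<in> Y" "Y \<subseteq> X" "k \<le> card Y" "i < k"
  obtains t where "t \<in> arrangements k Y" "t ! i = p"
proof -
  have "k - 1 \<le> card (Y - {p})" using assms finite_subset[OF assms(2) finite] by simp
  then obtain C where C: "C \<subseteq> Y - {p}" "card C = k - 1" "Finite_Set.finite C"
    by (rule obtain_subset_with_card_n)
  obtain ys where ys: "set ys = C" "distinct ys" using finite_distinct_list[OF C(3)] by blast
  have len: "length ys = k - 1" using ys C by (metis distinct_card)
  have split: "set ys = set (take i ys) \<union> set (drop i ys)"
    by (metis append_take_drop_id set_append)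
  have "set (take i ys) \<inter> set (drop i ys) = {}" using ys by (simp add: set_take_disj_set_drop_if_distinct)
  then have "take i ys @ p # drop i ys \<in> arrangements k Y"
    using C ys len assms split by (auto simp: arrangements_def)
  moreover have "(take i ys @ p # drop i ys) ! i = p"
    using len assms by (simp add: nth_append)
  ultimately show ?thesis by (rule that)
qed

text \<open>
  Words that have \<open>p\<close> in a prescribed position and avoid \<open>b\<close>, with only \<open>k\<close> letters for all positions
  together, so that linear combinations of the replacements of \<open>p\<close> by \<open>b\<close> fall under \<open>small\<close>.
\<close>

lemma column_exists:
  assumes "b \<in> X" "p \<in> X" "p \<noteq> b" "0 < k"
  shows "\<exists>v B. B \<subseteq> X \<and> card B \<le> N \<and> b \<in> B \<and>
    (\<forall>i<k. v i \<in> arrangements k (B - {b}) \<and> v i ! i = p)"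
proof -
  have "k - 1 \<le> card (X - {b, p})" using finite N assms by simp
  then obtain C where C: "C \<subseteq> X - {b, p}" "card C = k - 1" "Finite_Set.finite C"
    by (rule obtain_subset_with_card_n)
  let ?B = "insert b (insert p C)"
  have card_B: "card (?B - {b}) = k"
  proof -
    have "?B - {b} = insert p C" using C assms by auto
    then show ?thesis using C \<open>0 < k\<close> by (auto simp: card_insert_if)
  qed
  have "\<exists>t. t \<in> arrangements k (?B - {b}) \<and> t ! i = p" if "i < k" for i
  proof -
    have "p \<in> ?B - {b}" "?B - {b} \<subseteq> X" "k \<le> card (?B - {b})"
      using C assms card_B by auto
    from arrangement_with_entry[OF this that] show ?thesis by blast
  qed
  then obtain v where "\<forall>i<k. v i \<in> arrangements k (?B - {b}) \<and> v i ! i = p" by metis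
  moreover have notC: "p \<notin> C" "b \<notin> C" using C by auto
  moreover have "card ?B \<le> N" using assms C N notC \<open>0 < k\<close> by (simp add: card_insert_if)
  ultimately show ?thesis using C assms by (intro exI[of _ v] exI[of _ ?B]) auto
qed

text \<open>
  With \<open>D p i n\<close> for \<open>n\<close> times the replacement of \<open>p\<close> by \<open>b\<close> in position \<open>i\<close>, every word is congruent to
  a fixed word plus a sum of terms \<open>D p i\<close>.  For \<open>c\<close> in the kernel the multiples of the fixed word
  cancel, and collecting the terms by \<open>p\<close> leaves relations on few letters.
\<close>

lemma kernel_subset:
  assumes c: "keys c \<subseteq> arrangements k X" and ker: "word_exponent k w c = 0"
  shows "c \<in> H"
proof -
  have k: "0 < k" using degree_pos by (cases k) auto
  obtain b where b: "b \<in> X" using N by fastforce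
  obtain v B where vB: "\<And>p. p \<in> X \<Longrightarrow> p \<noteq> b \<Longrightarrow> B p \<subseteq> X \<and> card (B p) \<le> N \<and> b \<in> B p \<and>
    (\<forall>i<k. v p i \<in> arrangements k (B p - {b}) \<and> v p i ! i = p)"
    using column_exists[OF b _ _ k] by metis
  have v: "v p i \<in> arrangements k X" "v p i ! i = p" "b \<notin> set (v p i)" if "p \<in> X" "p \<noteq> b" "i < k" for p i
    using vB[OF that(1,2)] that(3) by (auto simp: arrangements_def)
  define D where "D p i n = (if p = b then 0 else move i b n (v p i))" for p i n
  have addD: "add_hom (D p i)" for p i
    by (simp add: add_hom_def D_def single_add)
  have to_base: "move i b n u - D (u ! i) i n \<in> H"
    if "u \<in> arrangements k X" "b \<notin> set u" "i < k" for u i n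
  proof -
    have "u ! i \<in> set u" "u ! i \<in> X" using that by (auto simp: arrangements_def)
    moreover from this have "u ! i \<noteq> b" using that by auto
    ultimately show ?thesis using that v[of "u ! i" i] b
      by (auto simp: D_def intro!: move_independent)
  qed
  \<comment> \<open>The term for \<open>b\<close> itself is zero, so the cases in which \<open>b\<close> is a letter involved are separate.\<close>
  have move: "move i q n u - (D (u ! i) i n - D q i n) \<in> H"
    if u: "u \<in> arrangements k X" and i: "i < k" and q: "q \<in> X" "q \<notin> set u" for u i q n
  proof -
    have len: "length u = k" "distinct u" "u ! i \<in> X" "u ! i \<in> set u"
      using u i by (auto simp: arrangements_def)
    have uq: "u[i := q] \<in> arrangements k X" using q by (intro arrangements_update[OF u]) auto
    consider "q = b" | "u ! i = b" | "q \<noteq> b" "u ! i \<noteq> b" by blast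
    then show ?thesis
    proof cases
      case 1
      then show ?thesis using to_base[OF u] q i by (simp add: D_def)
    next
      case 2
      have "move i b n (u[i := q]) - D (u[i := q] ! i) i n \<in> H"
        using 2 q len i by (intro to_base[OF uq]) (auto simp: in_set_update_iff)
      moreover have "u[i := q, i := b] = u" using 2 by auto
      ultimately have H: "single (u[i := q]) n - single u n - D q i n \<in> H"
        using len i by simp
      have "move i q n u - (D (u ! i) i n - D q i n) = - (single (u[i := q]) n - single u n - D q i n)"
        using 2 by (simp add: D_def)
      then show ?thesis using uminus[OF H] by (simp only:)
    next
      case 3
      \<comment> \<open>Since \<open>u\<close> may contain \<open>b\<close>, pass to a word \<open>t\<close> without \<open>b\<close>.  There the replacement of \<open>u ! i\<close>
        by \<open>q\<close> is that of \<open>u ! i\<close> by \<open>b\<close> minus that of \<open>q\<close> by \<open>b\<close>.\<close>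
      have "k \<le> card (X - {b, q})" using N finite b q 3 by simp
      moreover have "u ! i \<in> X - {b, q}" using 3 len q by auto
      ultimately obtain t where t: "t \<in> arrangements k (X - {b, q})" "t ! i = u ! i"
        using i by (metis Diff_subset arrangement_with_entry)
      then have tX: "t \<in> arrangements k X" "b \<notin> set t" "q \<notin> set t" "length t = k" "distinct t"
        by (auto simp: arrangements_def)
      have "t[i := q] \<in> arrangements k X" using q tX by (intro arrangements_update[OF tX(1)]) auto
      then have "move i b n (t[i := q]) - D (t[i := q] ! i) i n \<in> H"
        using tX 3 i by (intro to_base) (auto simp: in_set_update_iff)
      then have a1: "single (t[i := q]) n - single (t[i := b]) n - D q i n \<in> H" using tX i by simp
      have a2: "move i b n t - D (u ! i) i n \<in> H"
        using to_base[OF tX(1,2) i] t by simp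
      have a3: "move i q n u - move i q n t \<in> H"
        using move_independent[OF u tX(1) i] t q tX by simp
      have "(move i q n u - move i q n t) + (move i b n t - D (u ! i) i n)
          - (single (t[i := q]) n - single (t[i := b]) n - D q i n) \<in> H"
        by (intro diff add a1 a2 a3)
      then show ?thesis by (simp add: algebra_simps)
    qed
  qed
  obtain u0 where u0: "u0 \<in> arrangements k X"
    using arrangement_with_entry[OF b order_refl, of 0] k N by auto
  define S where "S n u = (\<Sum>i<k. D (u ! i) i n)" for n u
  have decompose: "single u n - single u0 n - (S n u - S n u0) \<in> H" if "u \<in> arrangements k X" for u n
  proof (rule arrangement_connected[OF finite _ u0 that])
    show "k < card X" using N by simp
    show "single u0 n - single u0 n - (S n u0 - S n u0) \<in> H" using zero by simp
  next
    fix u j z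
    assume u: "u \<in> arrangements k X" and j: "j < k" "u ! j \<noteq> u0 ! j" and z: "z \<in> X - set u"
      and IH: "single (u[j := z]) n - single u0 n - (S n (u[j := z]) - S n u0) \<in> H"
    have "(\<Sum>i<k. D (u ! i) i n - D (u[j := z] ! i) i n) =
      (\<Sum>i<k. if i = j then D (u ! j) j n - D z j n else 0)"
      using u by (intro sum.cong) (auto simp: arrangements_def)
    then have "S n u - S n (u[j := z]) = D (u ! j) j n - D z j n"
      using j by (simp add: S_def flip: sum_subtractf)
    moreover have "move j z n u - (D (u ! j) j n - D z j n) \<in> H"
      using u j z by (intro move) auto
    ultimately have "move j z n u - (S n u - S n (u[j := z])) \<in> H" by simp
    from add[OF this IH] show "single u n - single u0 n - (S n u - S n u0) \<in> H"
      by (simp add: algebra_simps)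
  qed
  \<comment> \<open>The coordinates of the exponent of a word add up to the degree, which is positive.\<close>
  have coeff_sum: "(\<Sum>u\<in>keys c. lookup c u) = 0"
  proof -
    define total where "total e = (\<Sum>x\<in>keys e. lookup e x)" for e :: "'v \<Rightarrow>\<^sub>0 int"
    have total: "add_hom total"
      unfolding total_def[abs_def] by (rule add_hom_keys_sum) (simp add: add_hom_def)
    have [simp]: "total (single x n) = n" for x n by (simp add: total_def)
    have "0 = total (word_exponent k w c)" by (simp add: ker add_hom_0[OF total])
    also have "\<dots> = (\<Sum>u\<in>keys c. \<Sum>j<k. lookup c u * of_nat (w j))"
      by (simp add: word_exponent_def add_hom_sum[OF total])
    also have "\<dots> = (\<Sum>u\<in>keys c. lookup c u) * int (\<Sum>j<k. w j)"
      by (simp add: sum_product)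
    finally have "(\<Sum>u\<in>keys c. lookup c u) * int (\<Sum>j<k. w j) = 0" by (rule sym)
    moreover have "int (\<Sum>j<k. w j) \<noteq> 0" using degree_pos by (simp only: of_nat_eq_0_iff)
    ultimately show ?thesis by (simp only: mult_eq_0_iff simp_thms)
  qed
  define n where "n i p = (\<Sum>u\<in>keys c. lookup c u when u ! i = p)" for i p
  have column: "(\<Sum>i<k. D p i (n i p)) \<in> H" if p: "p \<in> X" for p
  proof (cases "p = b")
    case False
    have D: "D p i m = move i b m (v p i)" for i m using False by (simp add: D_def)
    have "lookup (word_exponent k w c) p = (\<Sum>u\<in>keys c. \<Sum>j<k. lookup c u * of_nat (w j) when u ! j = p)"
      by (simp add: word_exponent_def lookup_sum lookup_single)
    also have "\<dots> = (\<Sum>j<k. n j p * of_nat (w j))"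
      unfolding n_def sum_distrib_right by (subst sum.swap) (simp add: when_mult)
    finally have n0: "(\<Sum>j<k. n j p * of_nat (w j)) = 0" by (simp add: ker)
    show ?thesis
    proof (rule small)
      show "B p \<subseteq> X" "card (B p) \<le> N" using vB[OF p False] by auto
      have "keys (D p i (n i p)) \<subseteq> arrangements k (B p)" if i: "i < k" for i
      proof -
        have 1: "v p i \<in> arrangements k (B p - {b})" "b \<in> B p" using vB[OF p False] i by auto
        then have "v p i \<in> arrangements k (B p)" by (auto simp: arrangements_def)
        moreover have "(v p i)[i := b] \<in> arrangements k (B p)"
          using 1 by (intro arrangements_update[OF 1(1)]) (auto simp: arrangements_def)
        ultimately show ?thesis
          using keys_diff[of "single (v p i) (n i p)" "single ((v p i)[i := b]) (n i p)"]
          by (auto simp: D split: if_splits)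
      qed
      then show "keys (\<Sum>i<k. D p i (n i p)) \<subseteq> arrangements k (B p)"
        using keys_sum[of "\<lambda>i. D p i (n i p)" "{..<k}"] by blast
      have "word_exponent k w (\<Sum>i<k. D p i (n i p)) =
          (\<Sum>i<k. single p (n i p * of_nat (w i)) - single b (n i p * of_nat (w i)))"
        unfolding add_hom_sum[OF add_hom_word_exponent] D
        using v[OF p False] by (intro sum.cong) (auto simp: word_exponent_update_diff arrangements_def)
      also have "\<dots> = single p (\<Sum>i<k. n i p * of_nat (w i)) - single b (\<Sum>i<k. n i p * of_nat (w i))"
        by (simp add: sum_subtractf add_hom_sum[OF add_hom_single])
      finally show "word_exponent k w (\<Sum>i<k. D p i (n i p)) = 0" by (simp add: n0)
    qed
  qed (simp add: D_def zero)
  have S0: "(\<Sum>u\<in>keys c. S (lookup c u) u0) = 0"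
  proof -
    have "(\<Sum>u\<in>keys c. S (lookup c u) u0) = (\<Sum>i<k. D (u0 ! i) i (\<Sum>u\<in>keys c. lookup c u))"
      unfolding S_def by (subst sum.swap) (simp add: add_hom_sum[OF addD])
    then show ?thesis by (simp add: coeff_sum add_hom_0[OF addD])
  qed
  have "S (lookup c u) u = (\<Sum>p\<in>X. \<Sum>i<k. D p i (lookup c u when u ! i = p))" if "u \<in> keys c" for u
  proof -
    have "length u = k" "set u \<subseteq> X" using \<open>u \<in> keys c\<close> c by (auto simp: arrangements_def)
    then have uX: "u ! i \<in> X" if "i < k" for i using that by auto
    have "(\<Sum>p\<in>X. D p i (lookup c u when u ! i = p)) = D (u ! i) i (lookup c u)" if "i < k" for i
    proof -
      have "(\<Sum>p\<in>X. D p i (lookup c u when u ! i = p)) =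
          (\<Sum>p\<in>X. if u ! i = p then D p i (lookup c u) else 0)"
        by (rule sum.cong) (auto simp: add_hom_0[OF addD])
      then show ?thesis using uX[OF that] finite by simp
    qed
    then show ?thesis unfolding S_def by (subst sum.swap) simp
  qed
  then have "(\<Sum>u\<in>keys c. S (lookup c u) u) = (\<Sum>u\<in>keys c. \<Sum>p\<in>X. \<Sum>i<k. D p i (lookup c u when u ! i = p))"
    by (rule sum.cong[OF refl])
  also have "\<dots> = (\<Sum>p\<in>X. \<Sum>i<k. D p i (n i p))"
    unfolding n_def add_hom_sum[OF addD]
    by (subst sum.swap, intro sum.cong refl, subst sum.swap) simp
  also have "\<dots> \<in> H" by (rule sum) (rule column)
  finally have SH: "(\<Sum>u\<in>keys c. S (lookup c u) u) \<in> H" .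
  have "(\<Sum>u\<in>keys c. single u (lookup c u) - single u0 (lookup c u)
      - (S (lookup c u) u - S (lookup c u) u0)) \<in> H"
    using c by (intro sum decompose) auto
  moreover have "(\<Sum>u\<in>keys c. single u0 (lookup c u)) = 0"
    using add_hom_sum[OF add_hom_single[of u0], of "lookup c" "keys c"]
    by (simp only: coeff_sum single_zero)
  ultimately have "c - (\<Sum>u\<in>keys c. S (lookup c u) u) \<in> H"
    by (simp only: sum_subtractf sum_of_singles[symmetric] S0 diff_0_right)
  from add[OF this SH] show ?thesis by simp
qed

end

section \<open>Kernels of push-forwards as binomial ideals\<close>

lemma mpoly_ring_simps [simp]:
  "a \<otimes>\<^bsub>mpoly_ring V\<^esub> b = a * b" "\<one>\<^bsub>mpoly_ring V\<^esub> = 1"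
  "a \<oplus>\<^bsub>mpoly_ring V\<^esub> b = a + b" "\<zero>\<^bsub>mpoly_ring V\<^esub> = 0"
  by (simp_all add: mpoly_ring_def)

lemma in_mpoly_ring_iff: "p \<in> carrier (mpoly_ring V) \<longleftrightarrow> (\<forall>e\<in>keys p. keys e \<subseteq> V)"
  by (simp add: mpoly_ring_def)

lemma single_in_mpoly_ring: "keys e \<subseteq> V \<Longrightarrow> single e c \<in> carrier (mpoly_ring V)"
  by (simp add: in_mpoly_ring_iff)

lemma mpoly_ring_mono: "V \<subseteq> W \<Longrightarrow> carrier (mpoly_ring V) \<subseteq> carrier (mpoly_ring W)"
  by (simp add: mpoly_ring_def Collect_mono_iff) (meson subset_trans)

lemma push_keys_in_mpoly_ring:
  assumes "\<And>e. e \<in> keys p \<Longrightarrow> keys (h e) \<subseteq> V"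
  shows "push_keys h p \<in> carrier (mpoly_ring V)"
  unfolding in_mpoly_ring_iff
proof
  fix b assume "b \<in> keys (push_keys h p)"
  then have "b \<in> h ` keys p" using keys_push_keys[of h p] by (rule rev_subsetD)
  then show "keys b \<subseteq> V" using assms by auto
qed

lemma ring_mpoly_ring: "ring (mpoly_ring V)"
  using cring_mpoly_ring by (rule cring.axioms(1))

text \<open>This is the common form of the toric ideals and of their Laurent ideals.\<close>

definition push_kernel :: "'v set \<Rightarrow> (('v \<Rightarrow>\<^sub>0 'e::comm_monoid_add) \<Rightarrow> 'y) \<Rightarrow>
    (('v \<Rightarrow>\<^sub>0 'e) \<Rightarrow>\<^sub>0 'a::comm_ring_1) set" where
  "push_kernel V h = {p \<in> carrier (mpoly_ring V). push_keys h p = 0}"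

lemma ideal_push_kernel:
  fixes h :: "('v \<Rightarrow>\<^sub>0 'e::comm_monoid_add) \<Rightarrow> ('w \<Rightarrow>\<^sub>0 'f::comm_monoid_add)"
  assumes "add_hom h"
  shows "ideal (push_kernel V h :: (('v \<Rightarrow>\<^sub>0 'e) \<Rightarrow>\<^sub>0 'a::comm_ring_1) set) (mpoly_ring V)"
proof -
  let ?S = "mpoly_ring UNIV :: (('w \<Rightarrow>\<^sub>0 'f) \<Rightarrow>\<^sub>0 'a) ring"
  have "push_keys h \<in> ring_hom (mpoly_ring V) ?S"
  proof (rule ring_hom_memI)
    fix x y :: "('v \<Rightarrow>\<^sub>0 'e) \<Rightarrow>\<^sub>0 'a"
    show "push_keys h x \<in> carrier ?S" by (simp add: in_mpoly_ring_iff)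
    show "push_keys h (x \<otimes>\<^bsub>mpoly_ring V\<^esub> y) = push_keys h x \<otimes>\<^bsub>?S\<^esub> push_keys h y"
      by (simp add: push_keys_mult[OF assms])
    show "push_keys h (x \<oplus>\<^bsub>mpoly_ring V\<^esub> y) = push_keys h x \<oplus>\<^bsub>?S\<^esub> push_keys h y"
      by (simp add: add_hom_add[OF add_hom_push_keys])
    show "push_keys h \<one>\<^bsub>mpoly_ring V\<^esub> = \<one>\<^bsub>?S\<^esub>"
      by (simp add: push_keys_one add_hom_0[OF assms])
  qed
  then have "ring_hom_ring (mpoly_ring V) ?S (push_keys h)"
    by (rule ring_hom_ringI2[OF ring_mpoly_ring ring_mpoly_ring])
  then have "ideal (a_kernel (mpoly_ring V) ?S (push_keys h)) (mpoly_ring V)"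
    by (rule ring_hom_ring.kernel_is_ideal)
  then show ?thesis
    by (simp only: a_kernel_def' push_kernel_def mpoly_ring_simps)
qed

lemma ideal_sum:
  assumes "ideal I (mpoly_ring V)" "\<And>x. x \<in> S \<Longrightarrow> h x \<in> I"
  shows "sum h S \<in> I"
proof -
  interpret ideal I "mpoly_ring V" by (rule assms)
  have "0 \<in> I" "x + y \<in> I" if "x \<in> I" "y \<in> I" for x y
    using that additive_subgroup.a_closed[OF is_additive_subgroup, of x y]
      additive_subgroup.zero_closed[OF is_additive_subgroup] by simp_all
  then show ?thesis using assms(2) additive_subgroup.zero_closed[OF is_additive_subgroup]
    by (induction S rule: infinite_finite_induct) simp_all
qed

lemma ideal_minus:
  assumes "ideal I (mpoly_ring V)" "p \<in> I"
  shows "- p \<in> I"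
proof -
  interpret ideal I "mpoly_ring V" by (rule assms)
  have "single 0 (- 1) * p \<in> I"
    using I_l_closed[OF assms(2) single_in_mpoly_ring[of 0 V "- 1"]] by simp
  then show ?thesis by (simp add: single_uminus)
qed

text \<open>
  Choose a representative \<open>r\<close> for the exponents of \<open>p\<close> with a given image under \<open>h\<close>.  Moving each term
  of \<open>p\<close> to its representative gives a push-forward of \<open>push_keys h p\<close>, hence zero, and the
  difference of a term and its moved copy is a multiple of a binomial.
\<close>

lemma push_kernel_subset_ideal:
  fixes h :: "('v \<Rightarrow>\<^sub>0 int) \<Rightarrow> 'y::ab_group_add" and I :: "('v, 'a::comm_ring_1) laurent set"
  assumes I: "ideal I (mpoly_ring V)" and h: "add_hom h"
    and binomial: "\<And>c. keys c \<subseteq> V \<Longrightarrow> h c = 0 \<Longrightarrow> single c 1 - 1 \<in> I"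
  shows "push_kernel V h \<subseteq> I"
proof
  fix p :: "('v, 'a) laurent"
  assume "p \<in> push_kernel V h"
  then have p: "\<And>e. e \<in> keys p \<Longrightarrow> keys e \<subseteq> V" and ker: "push_keys h p = 0"
    by (auto simp: push_kernel_def in_mpoly_ring_iff)
  interpret ideal I "mpoly_ring V" by (rule I)
  define r where "r y = (SOME e. e \<in> keys p \<and> h e = y)" for y
  have r: "r (h e) \<in> keys p" "h (r (h e)) = h e" if "e \<in> keys p" for e
    using someI[of "\<lambda>e'. e' \<in> keys p \<and> h e' = h e" e] that by (auto simp: r_def)
  have "p - push_keys (\<lambda>e. r (h e)) p =
      (\<Sum>e\<in>keys p. single e (lookup p e) - single (r (h e)) (lookup p e))"
    by (simp add: push_keys_def sum_subtractf flip: sum_of_singles)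
  also have "push_keys (\<lambda>e. r (h e)) p = 0"
    using push_keys_push_keys[of r h p] by (simp add: ker add_hom_0[OF add_hom_push_keys])
  also have "(\<Sum>e\<in>keys p. single e (lookup p e) - single (r (h e)) (lookup p e)) \<in> I"
  proof (rule ideal_sum[OF I])
    fix e assume e: "e \<in> keys p"
    have "keys (e - r (h e)) \<subseteq> V" using keys_diff[of e "r (h e)"] p[OF e] p[OF r(1)[OF e]] by blast
    then have "single (e - r (h e)) 1 - 1 \<in> I"
      using r[OF e] by (intro binomial) (auto simp: add_hom_diff[OF h])
    then have "single (r (h e)) (lookup p e) * (single (e - r (h e)) 1 - 1) \<in> I"
      using I_l_closed[OF _ single_in_mpoly_ring[OF p[OF r(1)[OF e]]]] by simp
    then show "single e (lookup p e) - single (r (h e)) (lookup p e) \<in> I"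
      by (simp add: right_diff_distrib mult_single)
  qed
  finally show "p \<in> I" by simp
qed

section \<open>Laurent ideals as kernels of push-forwards\<close>

lemma lookup_map_int [simp]: "lookup (Poly_Mapping.map int e) x = int (lookup e x)"
  by (simp add: Poly_Mapping.map.rep_eq when_def)

lemma lookup_map_nat [simp]: "lookup (Poly_Mapping.map nat e) x = nat (lookup e x)"
  by (simp add: Poly_Mapping.map.rep_eq when_def)

lemma add_hom_map_int: "add_hom (Poly_Mapping.map int)"
  by (intro add_homI poly_mapping_eqI) (simp_all add: lookup_add)

lemma keys_map_int [simp]: "keys (Poly_Mapping.map int e) = keys e"
  by (auto simp: in_keys_iff)

lemma inj_map_int: "inj (Poly_Mapping.map int :: ('v \<Rightarrow>\<^sub>0 nat) \<Rightarrow> _)"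
  by (rule injI) (metis lookup_map_int of_nat_eq_iff poly_mapping_eqI)

lemma inv_single:
  fixes e :: "'v \<Rightarrow>\<^sub>0 int"
  assumes "keys e \<subseteq> V"
  shows "inv\<^bsub>mpoly_ring V\<^esub> single e (1 :: 'a::comm_ring_1) = single (- e) 1"
proof -
  interpret cring "mpoly_ring V :: ('v, 'a) laurent ring" by (rule cring_mpoly_ring)
  show ?thesis
    using assms by (intro inv_unique'[symmetric] single_in_mpoly_ring) (simp_all add: mult_single)
qed

text \<open>
  Multiplication by a monomial does not lead out of the kernel.  Conversely, multiplying by a
  monomial of high degree makes all exponents natural numbers, where \<open>h\<close> restricts to \<open>h'\<close>.
\<close>

lemma laurent_ideal_push_kernel:
  fixes h :: "('v \<Rightarrow>\<^sub>0 int) \<Rightarrow> ('w \<Rightarrow>\<^sub>0 int)" and h' :: "('v \<Rightarrow>\<^sub>0 nat) \<Rightarrow> ('w \<Rightarrow>\<^sub>0 nat)"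
  assumes h: "add_hom h" and h': "\<And>e. h (Poly_Mapping.map int e) = Poly_Mapping.map int (h' e)"
  shows "laurent_ideal V (push_kernel V h' :: ('v, 'a::comm_ring_1) mpoly set) = push_kernel V h"
proof (intro equalityI subsetI)
  have comm: "push_keys h (to_laurent g) = to_laurent (push_keys h' g)" for g :: "('v, 'a) mpoly"
    by (simp add: to_laurent_def push_keys_push_keys h')
  {
    fix p :: "('v, 'a) laurent"
    assume "p \<in> laurent_ideal V (push_kernel V h')"
    then obtain g :: "('v, 'a) mpoly" and e where g: "g \<in> push_kernel V h'" and e: "keys e \<subseteq> V"
      and p: "p = to_laurent g * inv\<^bsub>mpoly_ring V\<^esub> to_laurent (single e 1)"
      by (auto simp: laurent_ideal_def monomials_def)
    have "p = to_laurent g * single (- Poly_Mapping.map int e) 1"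
      using e by (simp add: p to_laurent_def inv_single)
    moreover have tl: "to_laurent g \<in> push_kernel V h"
    proof -
      have "to_laurent g \<in> carrier (mpoly_ring V)"
        using g unfolding to_laurent_def
        by (intro push_keys_in_mpoly_ring) (simp add: push_kernel_def in_mpoly_ring_iff)
      moreover have "push_keys h (to_laurent g) = 0"
        using g unfolding comm by (simp add: push_kernel_def to_laurent_def add_hom_0[OF add_hom_push_keys])
      ultimately show ?thesis by (simp add: push_kernel_def)
    qed
    ultimately show "p \<in> push_kernel V h"
      using ideal.I_r_closed[OF ideal_push_kernel[OF h] tl, of "single (- Poly_Mapping.map int e) 1"] e
      by (simp add: in_mpoly_ring_iff)
  }
  fix p :: "('v, 'a) laurent"
  assume p: "p \<in> push_kernel V h"
  \<comment> \<open>The sum of the negative parts of all exponents of \<open>p\<close> bounds each of them.\<close>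
  define e where "e = (\<Sum>c\<in>keys p. Poly_Mapping.map nat (- c))"
  have "keys e \<subseteq> (\<Union>c\<in>keys p. keys (Poly_Mapping.map nat (- c)))"
    unfolding e_def by (auto simp: in_keys_iff lookup_sum)
  also have "\<dots> \<subseteq> (\<Union>c\<in>keys p. keys c)"
    by (intro UN_mono subset_refl subsetI) (simp add: in_keys_iff)
  also have "\<dots> \<subseteq> V"
    using p by (auto simp only: push_kernel_def in_mpoly_ring_iff)
  finally have e: "keys e \<subseteq> V" .
  define q where "q = p * single (Poly_Mapping.map int e) 1"
  define g where "g = push_keys (Poly_Mapping.map nat) q"
  have q: "q \<in> push_kernel V h"
    unfolding q_def
    using ideal.I_r_closed[OF ideal_push_kernel[OF h] p, of "single (Poly_Mapping.map int e) 1"] e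
    by (simp add: in_mpoly_ring_iff)
  have "0 \<le> lookup b x" if "b \<in> keys q" for b x
  proof -
    obtain c where c: "c \<in> keys p" "b = c + Poly_Mapping.map int e"
      using keys_mult[of p "single (Poly_Mapping.map int e) 1"] \<open>b \<in> keys q\<close>
      by (auto simp: q_def split: if_splits)
    have "nat (- lookup c x) \<le> lookup e x"
      unfolding e_def lookup_sum
      using member_le_sum[of c "keys p" "\<lambda>c. nat (- lookup c x)"] c by simp
    then show ?thesis by (simp add: c lookup_add)
  qed
  then have "to_laurent g = q"
    unfolding to_laurent_def g_def push_keys_push_keys
    by (intro push_keys_ident poly_mapping_eqI) simp
  have "g \<in> carrier (mpoly_ring V)"
    unfolding g_def
  proof (rule push_keys_in_mpoly_ring)
    fix b assume "b \<in> keys q"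
    then have "keys b \<subseteq> V" using q by (simp add: push_kernel_def in_mpoly_ring_iff)
    then show "keys (Poly_Mapping.map nat b) \<subseteq> V" by (auto simp: in_keys_iff)
  qed
  moreover have "push_keys h' g = 0"
  proof (rule push_keys_inj_eq_0[OF inj_map_int])
    have "push_keys h q = 0" using q by (simp add: push_kernel_def)
    then show "push_keys (Poly_Mapping.map int) (push_keys h' g) = 0"
      using comm[of g] \<open>to_laurent g = q\<close> by (simp add: to_laurent_def)
  qed
  moreover have "p = q * single (- Poly_Mapping.map int e) 1"
    by (simp add: q_def mult.assoc mult_single)
  moreover have single_e: "to_laurent (single e (1::'a)) = single (Poly_Mapping.map int e) 1"
    by (simp add: to_laurent_def)
  ultimately have "p = to_laurent g \<otimes>\<^bsub>mpoly_ring V\<^esub> inv\<^bsub>mpoly_ring V\<^esub> to_laurent (single e 1) \<and>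
      g \<in> push_kernel V h' \<and> single e 1 \<in> monomials V"
    using e \<open>to_laurent g = q\<close>
    by (auto simp: push_kernel_def monomials_def single_e inv_single)
  then show "p \<in> laurent_ideal V (push_kernel V h')"
    unfolding laurent_ideal_def mem_Collect_eq by (intro exI[of _ g] exI[of _ "single e 1"]) simp
qed

section \<open>The toric map\<close>

lemma tuples_eq_arrangements: "tuples k n = arrangements k {1..n}"
  by (simp add: tuples_def arrangements_def)

lemma tuples_mono: "n \<le> m \<Longrightarrow> tuples k n \<subseteq> tuples k m"
  by (auto simp: tuples_eq_arrangements intro!: arrangements_mono)

lemma single_power_index: "single x (1::'a::comm_ring_1) ^ n = single (\<Sum>_<n. x) 1"
  for x :: "'e::comm_monoid_add"
  by (induction n) (simp_all add: mult_single add.commute)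

lemma prod_single: "(\<Prod>v\<in>S. single (x v) (1::'a::comm_ring_1)) = single (\<Sum>v\<in>S. x v) 1"
  for x :: "'v \<Rightarrow> 'e::comm_monoid_add"
  by (induction S rule: infinite_finite_induct) (simp_all add: mult_single)

lemma sum_const_nat_single: "(\<Sum>_<n. single y m) = single y (n * m :: nat)"
  by (induction n) (simp_all add: single_add[symmetric] add.commute)

text \<open>
  Substituting monomials acts on exponents as a homomorphism.  The constant sums are the multiples
  \<open>lookup e v\<close> times \<open>x v\<close>; exponents form an additive monoid, but not in general a ring.
\<close>

lemma subst_monomials:
  "subst (\<lambda>v. single (x v) (1::'a::comm_ring_1)) p =
    push_keys (\<lambda>e. \<Sum>v\<in>keys e. \<Sum>_<lookup e v. x v) p"
  unfolding subst_def push_keys_def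
  by (simp add: single_power_index prod_single mult_single)

lemma toric_map_monomial:
  fixes e :: "nat \<Rightarrow>\<^sub>0 nat"
  assumes "keys e \<subseteq> {1..k}"
  shows "toric_map (single e (1::'a::comm_ring_1)) = push_keys (word_exponent k (\<lambda>j. lookup e (Suc j)))"
proof -
  let ?w = "\<lambda>j. lookup e (Suc j)"
  have "subst (\<lambda>i. var (u ! (i - 1))) (single e (1::'a)) =
      single (\<Sum>j<k. single (u ! j) (?w j)) 1" for u :: "nat list"
  proof -
    have "(\<Sum>i\<in>keys e. single (u ! (i - 1)) (lookup e i)) = (\<Sum>i\<in>{1..k}. single (u ! (i - 1)) (lookup e i))"
      using assms by (intro sum.mono_neutral_left) (auto simp: in_keys_iff)
    also have "\<dots> = (\<Sum>j<k. single (u ! j) (?w j))"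
      by (rule sum.reindex_bij_witness[of _ Suc "\<lambda>i. i - 1"]) auto
    finally show ?thesis
      by (simp add: var_def subst_monomials sum_const_nat_single del: sum_constant)
  qed
  then have "toric_map (single e (1::'a)) p =
      push_keys (\<lambda>c. \<Sum>u\<in>keys c. \<Sum>_<lookup c u. \<Sum>j<k. single (u ! j) (?w j)) p" for p
    unfolding toric_map_def by (simp add: subst_monomials del: sum_constant)
  moreover have "(\<Sum>u\<in>keys c. \<Sum>_<lookup c u. \<Sum>j<k. single (u ! j) (?w j)) = word_exponent k ?w c"
    for c :: "nat list \<Rightarrow>\<^sub>0 nat"
    unfolding word_exponent_def
    by (rule sum.cong[OF refl], subst sum.swap) (simp add: sum_const_nat_single del: sum_constant)
  ultimately show ?thesis by (simp add: fun_eq_iff)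
qed

lemma word_exponent_map_int:
  "word_exponent k w (Poly_Mapping.map int c) = Poly_Mapping.map int (word_exponent k w c)"
  by (rule add_hom_eqI[where p = c])
    (auto intro!: add_hom_comp[of "word_exponent k w" "Poly_Mapping.map int"]
        add_hom_comp[of "Poly_Mapping.map int" "word_exponent k w"] add_hom_word_exponent add_hom_map_int
      simp: word_exponent_single add_hom_sum[OF add_hom_map_int])

lemma toric_laurent_ideal_eq:
  assumes "keys e \<subseteq> {1..k}"
  shows "toric_laurent_ideal k (single e (1::'a::comm_ring_1)) n =
    push_kernel (tuples k n) (word_exponent k (\<lambda>j. lookup e (Suc j)))"
  unfolding toric_laurent_ideal_def toric_ideal_def toric_map_monomial[OF assms] a_kernel_def'
  using laurent_ideal_push_kernel[OF add_hom_word_exponent word_exponent_map_int, of "tuples k n"]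
  by (simp add: push_kernel_def)

section \<open>The action of the symmetric group\<close>

text \<open>
  The restriction on lengths matters: the default values of \<open>u ! j\<close> beyond the end of a word do not
  commute with \<open>\<sigma>\<close>.
\<close>

lemma word_exponent_map:
  assumes "\<And>u. u \<in> keys c \<Longrightarrow> length u = k"
  shows "word_exponent k w (push_keys (map \<sigma>) c) = push_keys \<sigma> (word_exponent k w c)"
  by (rule add_hom_eqI[where p = c])
    (auto intro!: add_hom_comp[of "word_exponent k w" "push_keys (map \<sigma>)"]
        add_hom_comp[of "push_keys \<sigma>" "word_exponent k w"] add_hom_word_exponent add_hom_push_keys
      simp: word_exponent_single add_hom_sum[OF add_hom_push_keys] assms)

lemma keys_push_map:
  assumes "keys c \<subseteq> arrangements k B" "inj_on \<sigma> B" "\<sigma> ` B \<subseteq> C"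
  shows "keys (push_keys (map \<sigma>) c) \<subseteq> arrangements k C"
proof
  fix u assume "u \<in> keys (push_keys (map \<sigma>) c)"
  then obtain v where "v \<in> keys c" "u = map \<sigma> v" using keys_push_keys[of "map \<sigma>" c] by auto
  then show "u \<in> arrangements k C"
    using assms by (fastforce simp: arrangements_def distinct_map intro: inj_on_subset)
qed

lemma perm_act_push_kernel:
  assumes p: "p \<in> push_kernel (tuples k n) (word_exponent k w)" and "n \<le> m" "\<sigma> permutes {1..m}"
  shows "perm_act \<sigma> p \<in> push_kernel (tuples k m) (word_exponent k w)"
proof -
  have supp: "keys c \<subseteq> arrangements k {1..n}" if "c \<in> keys p" for c
    using p that by (simp add: push_kernel_def in_mpoly_ring_iff tuples_eq_arrangements)
  have "\<sigma> ` {1..n} \<subseteq> {1..m}" "inj_on \<sigma> {1..n}"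
    using permutes_image[OF assms(3)] permutes_inj[OF assms(3)] \<open>n \<le> m\<close> by (auto intro: inj_on_subset)
  then have "perm_act \<sigma> p \<in> carrier (mpoly_ring (tuples k m))"
    unfolding perm_act_def tuples_eq_arrangements
    by (intro push_keys_in_mpoly_ring keys_push_map[OF supp]) auto
  moreover have "push_keys (word_exponent k w) (perm_act \<sigma> p) =
      push_keys (push_keys \<sigma>) (push_keys (word_exponent k w) p)"
    unfolding perm_act_def push_keys_push_keys
    using supp by (intro push_keys_cong word_exponent_map) (auto simp: arrangements_def)
  ultimately show ?thesis
    using p by (simp add: push_kernel_def add_hom_0[OF add_hom_push_keys])
qed

section \<open>Stabilization\<close>

lemma permutation_moving_into_initial_segment:
  assumes "B \<subseteq> {1..m}" "card B \<le> N" "N \<le> m"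
  obtains \<sigma> :: "nat \<Rightarrow> nat" where "\<sigma> permutes {1..m}" "\<sigma> ` B \<subseteq> {1..N}"
proof -
  obtain C where C: "B \<subseteq> C" "C \<subseteq> {1..m}" "card C = N"
    using exists_subset_between[of B N "{1..m}"] assms by auto
  have fin: "finite C" using C finite_subset by blast
  obtain f where f: "bij_betw f C {1..N}"
    using finite_same_card_bij[OF fin, of "{1..N}"] C by auto
  have "card ({1..m} - C) = card ({1..m} - {1..N})"
    using C fin assms(3) by (simp add: card_Diff_subset)
  then obtain g where g: "bij_betw g ({1..m} - C) ({1..m} - {1..N})"
    using finite_same_card_bij[of "{1..m} - C" "{1..m} - {1..N}"] by auto
  define \<sigma> where "\<sigma> x = (if x \<in> C then f x else if x \<in> {1..m} then g x else x)" for x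
  have "bij_betw \<sigma> C {1..N}"
    using f by (subst bij_betw_cong[where g = f]) (simp_all add: \<sigma>_def)
  moreover have "bij_betw \<sigma> ({1..m} - C) ({1..m} - {1..N})"
    using g by (subst bij_betw_cong[where g = g]) (simp_all add: \<sigma>_def)
  ultimately have "bij_betw \<sigma> (C \<union> ({1..m} - C)) ({1..N} \<union> ({1..m} - {1..N}))"
    by (rule bij_betw_combine) auto
  moreover have "C \<union> ({1..m} - C) = {1..m}" "{1..N} \<union> ({1..m} - {1..N}) = {1..m}"
    using C assms(3) by auto
  ultimately have "\<sigma> permutes {1..m}"
    using C by (intro bij_imp_permutes) (auto simp: \<sigma>_def)
  moreover have "\<sigma> ` B \<subseteq> {1..N}" using f C by (auto simp: \<sigma>_def bij_betw_def)
  ultimately show ?thesis by (rule that)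
qed

text \<open>\<open>x\<^bsup>a - b\<^esup> - 1 = x\<^bsup>- b\<^esup> ((x\<^sup>a - 1) - (x\<^sup>b - 1))\<close>\<close>

lemma exponents_of_ideal_closed:
  fixes I :: "('v, 'a::comm_ring_1) laurent set"
  assumes I: "ideal I (mpoly_ring V)" and b: "keys b \<subseteq> V"
    and "single a 1 - 1 \<in> I" "single b 1 - 1 \<in> I"
  shows "single (a - b) 1 - 1 \<in> I"
proof -
  interpret ideal I "mpoly_ring V" by (rule I)
  have "single a 1 - 1 + - (single b 1 - 1) \<in> I"
    using additive_subgroup.a_closed[OF is_additive_subgroup assms(3) ideal_minus[OF I assms(4)]] by simp
  then have "single (- b) 1 * (single a 1 - 1 + - (single b 1 - 1)) \<in> I"
    using I_l_closed[OF _ single_in_mpoly_ring[of "- b" V 1]] b by simp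
  then show ?thesis by (simp add: algebra_simps mult_single)
qed

text \<open>
  The exponents \<open>c\<close> with \<open>x\<^sup>c - 1 \<in> I\<close> form a group, which contains every relation on at most \<open>N\<close>
  letters because a permutation of \<open>{1..m}\<close> moves these letters into \<open>{1..N}\<close>.  If \<open>m = N\<close>, these are
  all relations; otherwise there is a spare letter, and the relations on few letters generate.
\<close>

lemma push_kernel_generated:
  fixes w :: "nat \<Rightarrow> nat"
  assumes I: "ideal (I :: (nat list, 'a::comm_ring_1) laurent set) (mpoly_ring (tuples k m))"
    and orbit: "sym_orbit m (push_kernel (tuples k N) (word_exponent k w)) \<subseteq> I"
    and N: "k < N" "N \<le> m"
    and free: "k + 2 \<le> N \<or> k \<le> 1 \<or> (\<exists>l<k. w l = 0)" and deg: "0 < (\<Sum>j<k. w j)"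
  shows "push_kernel (tuples k m) (word_exponent k w) \<subseteq> I"
proof (rule push_kernel_subset_ideal[OF I add_hom_word_exponent])
  interpret ideal I "mpoly_ring (tuples k m)" by (rule I)
  define H where "H = {c. keys c \<subseteq> tuples k m \<and> single c 1 - 1 \<in> I}"
  have small: "c \<in> H" if B: "B \<subseteq> {1..m}" "card B \<le> N" and c: "keys c \<subseteq> arrangements k B"
    and ker: "word_exponent k w c = 0" for B c
  proof -
    obtain \<sigma> :: "nat \<Rightarrow> nat" where \<sigma>: "\<sigma> permutes {1..m}" "\<sigma> ` B \<subseteq> {1..N}"
      using permutation_moving_into_initial_segment[OF B N(2)] .
    define c' where "c' = push_keys (map \<sigma>) c"
    have len: "length u = k" if "u \<in> keys c" for u using that c by (auto simp: arrangements_def)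
    have "keys c' \<subseteq> tuples k N"
      unfolding c'_def tuples_eq_arrangements
      using \<sigma> permutes_inj[OF \<sigma>(1)] by (intro keys_push_map[OF c]) (auto intro: inj_on_subset)
    moreover have ker': "word_exponent k w c' = 0"
      unfolding c'_def using len by (simp add: word_exponent_map ker add_hom_0[OF add_hom_push_keys])
    ultimately have "(single c' 1 - 1 :: (nat list, 'a) laurent) \<in>
        push_kernel (tuples k N) (word_exponent k w)"
      using keys_diff[of "single c' (1::'a)" 1]
      by (auto simp: push_kernel_def in_mpoly_ring_iff add_hom_diff[OF add_hom_push_keys]
          push_keys_one add_hom_0[OF add_hom_word_exponent] split: if_splits)
    moreover have "perm_act (inv_into UNIV \<sigma>) (single c' 1 - 1 :: (nat list, 'a) laurent) =
        single c 1 - 1"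
      using permutes_inverses(2)[OF \<sigma>(1)]
      by (simp add: perm_act_def add_hom_diff[OF add_hom_push_keys] push_keys_one
          add_hom_0[OF add_hom_push_keys] c'_def push_keys_push_keys push_keys_ident comp_def)
    ultimately have "single c 1 - 1 \<in> I"
      using orbit permutes_inv[OF \<sigma>(1)] unfolding sym_orbit_def by (smt (verit) mem_Collect_eq subsetD)
    moreover have "keys c \<subseteq> tuples k m"
      using c B arrangements_mono[of B "{1..m}" k] by (auto simp: tuples_eq_arrangements)
    ultimately show ?thesis by (simp add: H_def)
  qed
  fix c :: "nat list \<Rightarrow>\<^sub>0 int"
  assume c: "keys c \<subseteq> tuples k m" and ker: "word_exponent k w c = 0"
  have "c \<in> H"
  proof (cases "N = m")
    case True
    then show ?thesis using small[of "{1..m}"] c ker by (simp add: tuples_eq_arrangements)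
  next
    case False
    interpret locally_generated k N w "{1..m}" H
    proof
      show "0 \<in> H" using additive_subgroup.zero_closed[OF is_additive_subgroup] by (simp add: H_def)
      show "a - b \<in> H" if "a \<in> H" "b \<in> H" for a b
        using that exponents_of_ideal_closed[OF I, of b a] keys_diff[of a b] by (auto simp: H_def)
    qed (use small N False free deg in auto)
    show ?thesis using c ker by (intro kernel_subset) (auto simp: tuples_eq_arrangements)
  qed
  then show "single c 1 - 1 \<in> I" by (simp add: H_def)
qed

theorem theorem1p4:
  fixes f :: "(nat, 'a::field) mpoly" and k d :: nat
  assumes "k \<ge> 1"
    and "f \<in> monomials {1..k}"
    and "total_degree f = d"
    and "k < 2 * d"
  shows "invariant_chain k (toric_laurent_ideal k f) \<and>
         stabilization_bound k (toric_laurent_ideal k f) (2 * d)"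
proof -
  obtain e where e: "keys e \<subseteq> {1..k}" and f: "f = single e 1"
    using assms(2) by (auto simp: monomials_def)
  define w where "w j = lookup e (Suc j)" for j
  define J :: "nat \<Rightarrow> (nat list, 'a) laurent set"
    where "J n = push_kernel (tuples k n) (word_exponent k w)" for n
  have J: "toric_laurent_ideal k f = J"
    by (simp add: fun_eq_iff J_def f toric_laurent_ideal_eq[OF e] w_def[abs_def])
  have ideal_J: "ideal (J n) (mpoly_ring (tuples k n))" for n
    unfolding J_def by (rule ideal_push_kernel[OF add_hom_word_exponent])
  have orbit: "sym_orbit m (J n) \<subseteq> J m" if "n \<le> m" for n m
    using that by (auto simp: sym_orbit_def J_def intro: perm_act_push_kernel)
  have "J n \<subseteq> J (Suc n)" for n
    using mpoly_ring_mono[OF tuples_mono[of n "Suc n" k]] by (auto simp: J_def push_kernel_def)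
  then have chain: "invariant_chain k J"
    by (simp add: invariant_chain_def ideal_J orbit)
  have "d = (\<Sum>i\<in>keys e. lookup e i)"
    using assms(3) by (simp add: total_degree_def f)
  also have "\<dots> = (\<Sum>i\<in>{1..k}. lookup e i)"
    using e by (intro sum.mono_neutral_left) (auto simp: in_keys_iff)
  also have "\<dots> = (\<Sum>j<k. w j)"
    unfolding w_def by (rule sum.reindex_bij_witness[of _ Suc "\<lambda>i. i - 1"]) auto
  finally have d: "d = (\<Sum>j<k. w j)" .
  \<comment> \<open>If all \<open>w l\<close> are positive, then \<open>k \<le> d\<close>, whence \<open>k + 2 \<le> 2 * k \<le> 2 * d\<close> for \<open>k \<ge> 2\<close>.\<close>
  have free: "k + 2 \<le> 2 * d \<or> k \<le> 1 \<or> (\<exists>l<k. w l = 0)"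
  proof (rule ccontr)
    assume neg: "\<not> ?thesis"
    then have "(\<Sum>j<k. 1) \<le> (\<Sum>j<k. w j)" by (intro sum_mono) (auto simp: Suc_le_eq)
    then show False using neg d by simp
  qed
  have "Idl\<^bsub>mpoly_ring (tuples k m)\<^esub> (sym_orbit m (J (2 * d))) = J m" if m: "2 * d \<le> m" for m
  proof
    interpret ring "mpoly_ring (tuples k m) :: (nat list, 'a) laurent ring" by (rule ring_mpoly_ring)
    show "Idl\<^bsub>mpoly_ring (tuples k m)\<^esub> (sym_orbit m (J (2 * d))) \<subseteq> J m"
      by (rule genideal_minimal[OF ideal_J orbit[OF m]])
    have sub: "sym_orbit m (J (2 * d)) \<subseteq> carrier (mpoly_ring (tuples k m))"
      using orbit[OF m] by (auto simp: J_def push_kernel_def)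
    show "J m \<subseteq> Idl\<^bsub>mpoly_ring (tuples k m)\<^esub> (sym_orbit m (J (2 * d)))"
      unfolding J_def[of m]
      using genideal_self[OF sub] m assms(4) free d
      by (intro push_kernel_generated[OF genideal_ideal[OF sub], of "2 * d"]) (auto simp: J_def)
  qed
  then show ?thesis using chain assms(4) by (simp add: J stabilization_bound_def)
qed

end
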